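(* Let $k$ be a positive integer, let $a_j,b_j\in(0,\infty)$ for $j=0,\ldots,k$, let $a(x)=a_0\prod_{j=1}^k(x+a_j)$, $b(x)=b_0\prod_{j=1}^k(x+b_j)$, $x\in\mathbb{R}_+$, and assume that $b_1\le a_1\le b_2\le a_2\le\cdots\le b_k\le a_k$. Let $F$ and $G$ be two (possibly empty) subsets of $\{1,\ldots,k\}$ and $\{2,\ldots,k\}$, respectively. Let $c$ be any one of the following choices: $$c(x)=\prod_{j\in F}(x+a_j),\qquad c(x)=\prod_{j\in G}(x+b_j),\qquad x\in\mathbb{R}_+.$$ Then $\big\{\frac{c(m)}{b(m)+a(m)n}\big\}_{m,n\in\mathbb{Z}_+}$ is a minimal joint completely monotone net.
   Context: $\mathbb{Z}_+$ is the set of nonnegative integers and $\mathbb{R}_+$ the set of nonnegative reals. A product over the empty set is $1$. For a real sequence $\{u_k\}_{k\in\mathbb{Z}_+}$ put $\triangle u_k=u_{k+1}-u_k$; the sequence is completely monotone if $(-1)^j\triangle^j u_k\ge 0$ for all $j,k\in\mathbb{Z}_+$. For a real net $\{u_{m,n}\}_{m,n\in\mathbb{Z}_+}$ put $\triangle_1u_{m,n}=u_{m+1,n}-u_{m,n}$ and $\triangle_2u_{m,n}=u_{m,n+1}-u_{m,n}$. The net is joint completely monotone if $(-1)^{i+j}\triangle_1^i\triangle_2^j u_{m,n}\ge 0$ for all $i,j,m,n\in\mathbb{Z}_+$. A joint completely monotone net is minimal if for every $\epsilon>0$ neither of the sequences $\{u_{k,0}-\epsilon\mathbf{1}_{\{0\}}(k)\}_k$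 and $\{u_{0,k}-\epsilon\mathbf{1}_{\{0\}}(k)\}_k$ is completely monotone, where $\mathbf{1}_{\{0\}}$ is the indicator function of $\{0\}$. *)

theory Defs
  imports Complex_Main "HOL-Library.Indicator_Function"
begin

definition fdiff :: "(nat \<Rightarrow> real) \<Rightarrow> nat \<Rightarrow> real" where
  "fdiff u k = u (k + 1) - u k"

definition completely_monotone :: "(nat \<Rightarrow> real) \<Rightarrow> bool" where
  "completely_monotone u \<longleftrightarrow> (\<forall>j k. (-1) ^ j * (fdiff ^^ j) u k \<ge> 0)"

definition fdiff1 :: "(nat \<Rightarrow> nat \<Rightarrow> real) \<Rightarrow> nat \<Rightarrow> nat \<Rightarrow> real" where
  "fdiff1 u m n = u (m + 1) n - u m n"

definition fdiff2 :: "(nat \<Rightarrow> nat \<Rightarrow> real) \<Rightarrow> nat \<Rightarrow> nat \<Rightarrow> real" where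
  "fdiff2 u m n = u m (n + 1) - u m n"

definition joint_completely_monotone :: "(nat \<Rightarrow> nat \<Rightarrow> real) \<Rightarrow> bool" where
  "joint_completely_monotone u \<longleftrightarrow>
    (\<forall>i j m n. (-1) ^ (i + j) * (fdiff1 ^^ i) ((fdiff2 ^^ j) u) m n \<ge> 0)"

definition minimal_joint_completely_monotone :: "(nat \<Rightarrow> nat \<Rightarrow> real) \<Rightarrow> bool" where
  "minimal_joint_completely_monotone u \<longleftrightarrow>
    joint_completely_monotone u \<and>
    (\<forall>\<epsilon>>0. \<not> completely_monotone (\<lambda>k. u k 0 - \<epsilon> * indicat_real {0} k) \<and>
           \<not> completely_monotone (\<lambda>k. u 0 k - \<epsilon> * indicat_real {0} k))"

end

(* Write b/a = K - s. Interlacing makes the partial fraction coefficients of s nonnegative, so s is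
   completely monotone. The j-th difference of c/(b + a n) in n is, up to sign, c/a times j! times
   the product of the 1/(n + i + K - s) for i = 0, ..., j; each of these factors is completely monotone
   in m by the geometric series, and c/a is a product of completely monotone factors of the forms
   1/(m + q) and (m + p)/(m + q) with q <= p.

   For minimality it suffices that (-1)^j times the j-th difference at 0 of both boundary sequences
   tends to 0. This property is preserved by nonnegative linear combinations and by division by
   m + q with q > 0, and such operations build c/b and c(0)/(b(0) + a(0) n) from constants. *)
theory Submission
  imports Defs "HOL-Analysis.Harmonic_Numbers"
begin

section \<open>Signed iterated differences of a sequence\<close>

definition ndiff :: "nat \<Rightarrow> (nat \<Rightarrow> real) \<Rightarrow> nat \<Rightarrow> real" where
  "ndiff j u n = (-1) ^ j * (fdiff ^^ j) u n"

lemma completely_monotone_iff: "completely_monotone u \<longleftrightarrow> (\<forall>j n. ndiff j u n \<ge> 0)"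
  by (simp add: completely_monotone_def ndiff_def)

lemma ndiff_0 [simp]: "ndiff 0 u = u"
  by (simp add: ndiff_def fun_eq_iff)

lemma ndiff_Suc: "ndiff (Suc j) u n = ndiff j u n - ndiff j u (Suc n)"
  by (simp add: ndiff_def fdiff_def algebra_simps)

lemma ndiff_shift: "ndiff j (\<lambda>n. u (Suc n)) n = ndiff j u (Suc n)"
  by (induction j arbitrary: n) (simp_all add: ndiff_Suc)

lemma ndiff_diff: "ndiff j (\<lambda>n. u n - v n) n = ndiff j u n - ndiff j v n"
  by (induction j arbitrary: n) (simp_all add: ndiff_Suc)

lemma ndiff_add: "ndiff j (\<lambda>n. u n + v n) n = ndiff j u n + ndiff j v n"
  by (induction j arbitrary: n) (simp_all add: ndiff_Suc)

lemma ndiff_cmult: "ndiff j (\<lambda>n. x * u n) n = x * ndiff j u n"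
  by (induction j arbitrary: n) (simp_all add: ndiff_Suc algebra_simps)

lemma ndiff_const: "ndiff (Suc j) (\<lambda>n. x) n = 0"
  by (induction j arbitrary: n) (simp_all add: ndiff_Suc)

text \<open>Taking the new difference innermost permits inductions on \<open>j\<close> that
  generalise over the sequence.\<close>

lemma ndiff_Suc_inner: "ndiff (Suc j) u n = ndiff j (\<lambda>n. u n - u (Suc n)) n"
  by (simp add: ndiff_Suc ndiff_diff ndiff_shift)

lemma ndiff_inverse_shift:
  assumes "b > 0"
  shows "ndiff j (\<lambda>n. 1 / (real n + b)) n = fact j * (\<Prod>i\<le>j. 1 / (real (n + i) + b))"
proof (induction j arbitrary: n)
  case (Suc j)
  \<comment> \<open>\<open>P\<close> is the common part of the products at \<open>n\<close> and
    \<open>Suc n\<close>: the former has an extra first factor, the latter an extra last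
    one.\<close>
  define P where "P = (\<Prod>i<j. 1 / (real (Suc n + i) + b))"
  have pos: "real n + b > 0" "real (Suc n + j) + b > 0"
    using assms by auto
  have 1: "(\<Prod>i\<le>j. 1 / (real (n + i) + b)) = 1 / (real n + b) * P"
    unfolding P_def lessThan_Suc_atMost[symmetric] by (subst prod.lessThan_Suc_shift) simp
  have 2: "(\<Prod>i\<le>j. 1 / (real (Suc n + i) + b)) = P * (1 / (real (Suc n + j) + b))"
    unfolding P_def lessThan_Suc_atMost[symmetric] by (subst prod.lessThan_Suc) simp
  have 3: "(\<Prod>i\<le>Suc j. 1 / (real (n + i) + b)) = 1 / (real n + b) * (P * (1 / (real (Suc n + j) + b)))"
    unfolding 2[symmetric] lessThan_Suc_atMost[symmetric]
    by (subst prod.lessThan_Suc_shift) simp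
  show ?case
    unfolding ndiff_Suc Suc.IH 1 2 3 using pos by (simp add: divide_simps) (simp add: algebra_simps)
qed simp

text \<open>Leibniz rule: second and higher differences of \<open>n + b\<close> vanish, so only two
  terms survive.\<close>

lemma ndiff_linear_mult:
  "ndiff (Suc j) (\<lambda>n. (real n + b) * h n) n =
     (real n + b) * ndiff (Suc j) h n - real (Suc j) * ndiff j h (Suc n)"
proof (induction j arbitrary: n)
  case (Suc j)
  show ?case
    unfolding ndiff_Suc[of "Suc j"] Suc.IH
    by (simp add: ndiff_Suc algebra_simps)
qed (simp add: ndiff_Suc algebra_simps)

text \<open>All differences at positive arguments vanish, so each further difference at 0 subtracts
  0 from 1.\<close>

lemma ndiff_indicator_0: "ndiff j (indicat_real {0}) 0 = 1"
proof -
  have "ndiff j (indicat_real {0}) (Suc n) = 0" for j n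
    by (induction j arbitrary: n) (simp_all add: ndiff_Suc)
  then show ?thesis
    by (induction j) (simp_all add: ndiff_Suc)
qed

section \<open>Closure properties of completely monotone sequences\<close>

lemma completely_monotone_nonneg: "completely_monotone u \<Longrightarrow> u n \<ge> 0"
  unfolding completely_monotone_iff by (metis ndiff_0)

lemma completely_monotone_shift:
  "completely_monotone u \<Longrightarrow> completely_monotone (\<lambda>n. u (Suc n))"
  by (simp add: completely_monotone_iff ndiff_shift)

lemma completely_monotone_step:
  "completely_monotone u \<Longrightarrow> completely_monotone (\<lambda>n. u n - u (Suc n))"
  by (simp add: completely_monotone_iff flip: ndiff_Suc_inner)

lemma completely_monotone_le_0:
  assumes "completely_monotone u"
  shows "u n \<le> u 0"
proof (induction n)
  case (Suc n)
  with completely_monotone_nonneg[OF completely_monotone_step[OF assms], of n] show ?case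
    by simp
qed simp

lemma completely_monotone_add:
  "completely_monotone u \<Longrightarrow> completely_monotone v \<Longrightarrow> completely_monotone (\<lambda>n. u n + v n)"
  by (simp add: completely_monotone_iff ndiff_add)

lemma completely_monotone_const: "x \<ge> 0 \<Longrightarrow> completely_monotone (\<lambda>n. x)"
  unfolding completely_monotone_iff
proof safe
  fix j n
  assume "x \<ge> 0"
  then show "ndiff j (\<lambda>n. x) n \<ge> 0"
    by (cases j) (simp_all add: ndiff_const)
qed

lemma completely_monotone_mult:
  assumes "completely_monotone u" "completely_monotone v"
  shows "completely_monotone (\<lambda>n. u n * v n)"
proof -
  have "ndiff j (\<lambda>n. u n * v n) n \<ge> 0"
    if "completely_monotone u" "completely_monotone v" for j n u v
    using that
  proof (induction j arbitrary: u v)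
    case 0
    then show ?case
      by (simp add: completely_monotone_nonneg)
  next
    case (Suc j)
    \<comment> \<open>Discrete product rule: both summands are again products of completely monotone
      sequences, to which the hypothesis for \<open>j\<close> applies.\<close>
    have "(\<lambda>n. u n * v n - u (Suc n) * v (Suc n)) =
        (\<lambda>n. (u n - u (Suc n)) * v n + u (Suc n) * (v n - v (Suc n)))"
      by (simp add: fun_eq_iff algebra_simps)
    then show ?case
      using Suc.IH[OF completely_monotone_step[OF Suc.prems(1)] Suc.prems(2)]
        Suc.IH[OF completely_monotone_shift[OF Suc.prems(1)] completely_monotone_step[OF Suc.prems(2)]]
      by (simp add: ndiff_Suc_inner ndiff_add)
  qed
  with assms show ?thesis
    by (simp add: completely_monotone_iff)
qed

lemma completely_monotone_prod:
  "(\<And>i. i \<in> I \<Longrightarrow> completely_monotone (u i)) \<Longrightarrow> completely_monotone (\<lambda>n. \<Prod>i\<in>I. u i n)"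
  by (induction I rule: infinite_finite_induct)
    (auto intro: completely_monotone_mult completely_monotone_const)

lemma completely_monotone_sum:
  "(\<And>i. i \<in> I \<Longrightarrow> completely_monotone (u i)) \<Longrightarrow> completely_monotone (\<lambda>n. \<Sum>i\<in>I. u i n)"
  by (induction I rule: infinite_finite_induct)
    (auto intro: completely_monotone_add completely_monotone_const)

lemma completely_monotone_inverse_shift:
  "b > 0 \<Longrightarrow> completely_monotone (\<lambda>n. 1 / (real n + b))"
  by (auto simp: completely_monotone_iff ndiff_inverse_shift intro!: mult_nonneg_nonneg prod_nonneg)

lemma tendsto_ndiff:
  assumes "\<And>n. (\<lambda>p. u p n) \<longlonglongrightarrow> v n"
  shows "(\<lambda>p. ndiff j (u p) n) \<longlonglongrightarrow> ndiff j v n"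
  using assms by (induction j arbitrary: n) (auto simp: ndiff_Suc intro!: tendsto_diff)

lemma completely_monotone_limit:
  assumes "\<And>p. completely_monotone (u p)" and "\<And>n. (\<lambda>p. u p n) \<longlonglongrightarrow> v n"
  shows "completely_monotone v"
  unfolding completely_monotone_iff
proof safe
  fix j n
  show "ndiff j v n \<ge> 0"
    using assms(1) by (intro LIMSEQ_le_const[OF tendsto_ndiff[OF assms(2)]])
      (auto simp: completely_monotone_iff)
qed

text \<open>The geometric series \<open>1 / (K - s) = (\<Sum>p. s ^ p / K ^ (p + 1))\<close> has completely monotone terms.\<close>
lemma completely_monotone_inverse_diff:
  assumes s: "completely_monotone s" and K: "s 0 < K"
  shows "completely_monotone (\<lambda>n. 1 / (K - s n))"
proof -
  have K0: "K > 0"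
    using completely_monotone_nonneg[OF s, of 0] K by simp
  \<comment> \<open>Powers are written as finite products so that closure under products
    applies.\<close>
  have "(\<lambda>P. \<Sum>p<P. (1 / K) * (\<Prod>i<p. (1 / K) * s n)) \<longlonglongrightarrow> 1 / (K - s n)" for n
  proof -
    have "s n < K"
      using completely_monotone_le_0[OF s, of n] K by simp
    then have "norm (s n / K) < 1"
      using completely_monotone_nonneg[OF s, of n] K0 by simp
    from sums_mult[OF geometric_sums[OF this], of "1 / K"]
    have "(\<lambda>p. (1 / K) * (s n / K) ^ p) sums (1 / K * (1 / (1 - s n / K)))" .
    moreover have "1 / K * (1 / (1 - s n / K)) = 1 / (K - s n)"
      using K0 \<open>s n < K\<close> by (simp add: field_simps)
    ultimately show ?thesis
      by (simp add: sums_def)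
  qed
  moreover have "completely_monotone (\<lambda>n. \<Sum>p<P. (1 / K) * (\<Prod>i<p. (1 / K) * s n))" for P
    using K0 s by (intro completely_monotone_sum completely_monotone_mult completely_monotone_prod
        completely_monotone_const) auto
  ultimately show ?thesis
    by (rule completely_monotone_limit[rotated])
qed

section \<open>Joint complete monotonicity of nets\<close>

lemma funpow_fdiff2: "(fdiff2 ^^ j) u m n = (fdiff ^^ j) (u m) n"
  by (induction j arbitrary: n) (simp_all add: fdiff2_def fdiff_def)

lemma funpow_fdiff1: "(fdiff1 ^^ i) u m n = (fdiff ^^ i) (\<lambda>m. u m n) m"
  by (induction i arbitrary: m) (simp_all add: fdiff1_def fdiff_def)

lemma joint_completely_monotone_iff:
  "joint_completely_monotone u \<longleftrightarrow> (\<forall>j n. completely_monotone (\<lambda>m. ndiff j (u m) n))"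
proof -
  have "(-1) ^ (i + j) * (fdiff1 ^^ i) ((fdiff2 ^^ j) u) m n =
      ndiff i (\<lambda>m. ndiff j (u m) n) m" for i j m n
  proof -
    have "ndiff i (\<lambda>m. ndiff j (u m) n) m = (-1) ^ j * ndiff i (\<lambda>m. (fdiff ^^ j) (u m) n) m"
      unfolding ndiff_def[of j] by (rule ndiff_cmult)
    then show ?thesis
      by (simp add: ndiff_def funpow_fdiff1 funpow_fdiff2 power_add)
  qed
  then show ?thesis
    by (auto simp: joint_completely_monotone_def completely_monotone_iff)
qed

text \<open>The differences in \<open>n\<close> are explicit for fixed \<open>m\<close>; as
  functions of \<open>m\<close>, their factors are covered by the geometric series lemma with
  \<open>n + i + K\<close> in place of \<open>K\<close>.\<close>

lemma joint_completely_monotone_quotient: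
  assumes A: "completely_monotone A" and s: "completely_monotone s" and K: "s 0 < K"
  shows "joint_completely_monotone (\<lambda>m n. A m / (real n + (K - s m)))"
proof -
  have "completely_monotone (\<lambda>m. ndiff j (\<lambda>n. A m / (real n + (K - s m))) n)" for j n
  proof -
    have "ndiff j (\<lambda>n. A m / (real n + (K - s m))) n =
        A m * (fact j * (\<Prod>i\<le>j. 1 / ((real (n + i) + K) - s m)))" for m
    proof -
      have "K - s m > 0"
        using completely_monotone_le_0[OF s, of m] K by simp
      from ndiff_inverse_shift[OF this, of j n] ndiff_cmult[of j "A m" "\<lambda>n. 1 / (real n + (K - s m))" n]
      show ?thesis
        by (simp add: add_diff_eq)
    qed
    moreover have "completely_monotone
        (\<lambda>m. A m * (fact j * (\<Prod>i\<le>j. 1 / ((real (n + i) + K) - s m))))"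
      using K by (intro completely_monotone_mult completely_monotone_const completely_monotone_prod
          completely_monotone_inverse_diff A s) auto
    ultimately show ?thesis
      by simp
  qed
  then show ?thesis
    by (simp add: joint_completely_monotone_iff)
qed

section \<open>Sequences without atom at 0, and minimality\<close>

text \<open>In terms of the Hausdorff representing measure, the limit condition says that there is
  no atom at \<open>0\<close>.\<close>
definition no_atom_at_0 :: "(nat \<Rightarrow> real) \<Rightarrow> bool" where
  "no_atom_at_0 u \<longleftrightarrow> completely_monotone u \<and> (\<lambda>j. ndiff j u 0) \<longlonglongrightarrow> 0"

text \<open>Subtracting the indicator term lowers every signed difference at 0 by exactly
  \<epsilon>, but these differences tend to 0.\<close>

lemma not_completely_monotone_minus_indicator:
  assumes "no_atom_at_0 u" "\<epsilon> > 0"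
  shows "\<not> completely_monotone (\<lambda>n. u n - \<epsilon> * indicat_real {0} n)"
proof
  assume "completely_monotone (\<lambda>n. u n - \<epsilon> * indicat_real {0} n)"
  then have "ndiff j (\<lambda>n. u n - \<epsilon> * indicat_real {0} n) 0 \<ge> 0" for j
    by (simp add: completely_monotone_iff)
  then have "\<epsilon> \<le> ndiff j u 0" for j
    by (simp add: ndiff_diff ndiff_cmult ndiff_indicator_0)
  with assms show False
    using LIMSEQ_le_const[of "\<lambda>j. ndiff j u 0" 0 \<epsilon>] by (auto simp: no_atom_at_0_def)
qed

lemma no_atom_at_0_const: "x \<ge> 0 \<Longrightarrow> no_atom_at_0 (\<lambda>n. x)"
  unfolding no_atom_at_0_def
  \<comment> \<open>The index is shifted because only the differences of positive order
    vanish.\<close>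
  by (subst filterlim_sequentially_Suc[symmetric]) (simp add: completely_monotone_const ndiff_const)

lemma no_atom_at_0_add:
  "no_atom_at_0 u \<Longrightarrow> no_atom_at_0 v \<Longrightarrow> no_atom_at_0 (\<lambda>n. u n + v n)"
  using tendsto_add[of "\<lambda>j. ndiff j u 0" 0 _ "\<lambda>j. ndiff j v 0" 0]
  by (auto simp: no_atom_at_0_def ndiff_add completely_monotone_add)

lemma no_atom_at_0_cmult:
  assumes "no_atom_at_0 u" "x \<ge> 0"
  shows "no_atom_at_0 (\<lambda>n. x * u n)"
  using assms tendsto_mult_right_zero[of "\<lambda>j. ndiff j u 0" _ x]
  by (auto simp: no_atom_at_0_def ndiff_cmult intro: completely_monotone_mult completely_monotone_const)

text \<open>With \<open>h n = g n / (n + b)\<close>, the differences \<open>H j\<close>, \<open>G j\<close> of \<open>h\<close>, \<open>g\<close> at \<open>0\<close> satisfy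
  \<open>(j + 1) * (H j - H (j + 1)) = b * H (j + 1) - G (j + 1)\<close>. A positive limit of the decreasing
  sequence \<open>H\<close> would make its summable increments dominate a multiple of the harmonic series.\<close>
lemma no_atom_at_0_divide:
  assumes g: "no_atom_at_0 g" and b: "b > 0"
  shows "no_atom_at_0 (\<lambda>n. g n / (real n + b))"
proof -
  define h where "h = (\<lambda>n. g n / (real n + b))"
  define H where "H = (\<lambda>j. ndiff j h 0)"
  define G where "G = (\<lambda>j. ndiff j g 0)"
  have cm: "completely_monotone h"
    using completely_monotone_mult[OF _ completely_monotone_inverse_shift[OF b], of g] g
    by (simp add: h_def no_atom_at_0_def)
  have "g = (\<lambda>n. (real n + b) * h n)"
    using b by (auto simp: h_def fun_eq_iff)
  \<comment> \<open>This is the Leibniz rule at 0, where \<open>ndiff j h 1\<close> equals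
    \<open>H j - H (Suc j)\<close>.\<close>
  then have rec: "real (Suc j) * (H j - H (Suc j)) = b * H (Suc j) - G (Suc j)" for j
    using ndiff_linear_mult[of j b h 0] by (simp add: G_def H_def ndiff_Suc algebra_simps)
  have G: "G \<longlonglongrightarrow> 0"
    using g by (simp add: no_atom_at_0_def G_def)
  have H_nonneg: "H j \<ge> 0" for j
    using cm by (simp add: H_def completely_monotone_iff)
  have "H (Suc j) \<le> H j" for j
    using cm by (simp add: H_def completely_monotone_iff ndiff_Suc[of j h 0])
  then have "decseq H"
    by (rule decseq_SucI)
  then obtain L where L: "H \<longlonglongrightarrow> L" and L_le: "\<And>j. L \<le> H j"
    using decseq_convergent[of H 0] H_nonneg by blast
  have "L = 0"
  proof (rule ccontr)
    assume "L \<noteq> 0"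
    moreover have "L \<ge> 0"
      using L H_nonneg by (intro LIMSEQ_le_const[of H]) auto
    ultimately have "b * L / 2 > 0"
      using b by simp
    \<comment> \<open>Since \<open>b * H (Suc j)\<close> is at least \<open>b * L\<close>, a bound
      of half that on \<open>G\<close> leaves at least \<open>b * L / 2\<close> on the right of
      \<open>rec\<close>.\<close>
    with G have "eventually (\<lambda>j. G j < b * L / 2) sequentially"
      by (rule order_tendstoD(2))
    then have "eventually (\<lambda>j. G (Suc j) < b * L / 2) sequentially"
      by (subst eventually_sequentially_Suc)
    then have ev: "eventually (\<lambda>j. norm (1 / real (Suc j)) \<le> 2 / (b * L) * (H j - H (Suc j))) sequentially"
    proof eventually_elim
      case (elim j)
      have "b * L \<le> b * H (Suc j)"
        using L_le b by simp
      with elim have "b * L / 2 \<le> real (Suc j) * (H j - H (Suc j))"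
        unfolding rec by simp
      with \<open>b * L / 2 > 0\<close> show ?case
        by (simp add: field_simps)
    qed
    have "summable (\<lambda>j. 2 / (b * L) * (H j - H (Suc j)))"
      using telescope_summable'[OF L] by (rule summable_mult)
    from summable_comparison_test_ev[OF ev this] have "summable (\<lambda>j. 1 / real (Suc j))" .
    then have "summable (\<lambda>j. 1 / real j)"
      by (subst (asm) summable_Suc_iff)
    with not_summable_harmonic[where 'a = real] show False
      by (simp add: inverse_eq_divide)
  qed
  with L cm show ?thesis
    by (simp add: no_atom_at_0_def h_def H_def)
qed

text \<open>Denominators are added one at a time. An unpaired one is a division; a paired one
  multiplies by \<open>1 + (p i - q i) / (n + q i)\<close>, whose numerator is nonnegative.\<close>

lemma no_atom_at_0_prod_quotient:
  assumes "finite S" "T \<subseteq> S" and q: "\<And>j. j \<in> S \<Longrightarrow> q j > 0"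
    and pq: "\<And>j. j \<in> T \<Longrightarrow> q j \<le> p j"
  shows "no_atom_at_0 (\<lambda>n. (\<Prod>j\<in>T. (real n + p j)) / (\<Prod>j\<in>S. (real n + q j)))"
  using assms
proof (induction S arbitrary: T rule: finite_induct)
  case empty
  then show ?case
    by (simp add: no_atom_at_0_const)
next
  case (insert i S)
  define u where "u n = (\<Prod>j\<in>T - {i}. (real n + p j)) / (\<Prod>j\<in>S. (real n + q j))" for n
  have u: "no_atom_at_0 u"
    unfolding u_def using insert.prems by (intro insert.IH) auto
  have qi: "q i > 0" and T: "finite T"
    using insert by (auto intro: finite_subset)
  show ?case
  proof (cases "i \<in> T")
    case True
    have "(\<Prod>j\<in>T. (real n + p j)) / (\<Prod>j\<in>insert i S. (real n + q j)) =
        u n + (p i - q i) * (u n / (real n + q i))" for n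
    proof -
      have "(\<Prod>j\<in>T. (real n + p j)) / (\<Prod>j\<in>insert i S. (real n + q j)) =
          (real n + p i) / (real n + q i) * u n"
        using insert.hyps T True by (simp add: u_def prod.remove[of T i])
      also have "(real n + p i) / (real n + q i) = 1 + (p i - q i) / (real n + q i)"
        using qi by (simp add: field_simps)
      finally show ?thesis
        by (simp add: algebra_simps)
    qed
    then show ?thesis
      using u qi insert.prems(3)[OF True]
      by (simp add: no_atom_at_0_add no_atom_at_0_cmult no_atom_at_0_divide)
  next
    case False
    then have "(\<Prod>j\<in>T. (real n + p j)) / (\<Prod>j\<in>insert i S. (real n + q j)) =
        u n / (real n + q i)" for n
      using insert.hyps by (simp add: u_def mult.commute)
    then show ?thesis
      using no_atom_at_0_divide[OF u qi] by simp
  qed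
qed

section \<open>Partial fractions of interlacing quotients\<close>

text \<open>Coinciding poles \<open>a i = a (Suc n)\<close> force \<open>b (Suc n) = a (Suc n)\<close>: this is the case
  \<open>A = B\<close>, in which the new factor is \<open>1\<close>.\<close>
lemma interlacing_partial_fractions:
  fixes a b :: "nat \<Rightarrow> real"
  assumes a_pos: "\<And>j. 1 \<le> j \<Longrightarrow> j \<le> k \<Longrightarrow> a j > 0"
    and b_le_a: "\<And>j. 1 \<le> j \<Longrightarrow> j \<le> k \<Longrightarrow> b j \<le> a j"
    and a_le_b: "\<And>i j. 1 \<le> i \<Longrightarrow> i < j \<Longrightarrow> j \<le> k \<Longrightarrow> a i \<le> b j"
  shows "\<exists>w. (\<forall>j. w j \<ge> 0) \<and>
    (\<forall>x\<ge>0. (\<Prod>j=1..k. (x + b j) / (x + a j)) = 1 - (\<Sum>j=1..k. w j / (x + a j)))"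
  using assms
proof (induction k)
  case 0
  then show ?case
    by (auto intro!: exI[of _ "\<lambda>_. 0"])
next
  case (Suc n)
  define A B where "A = a (Suc n)" and "B = b (Suc n)"
  from Suc obtain w where w: "\<And>j. w j \<ge> 0"
    and eq: "\<And>x. x \<ge> 0 \<Longrightarrow> (\<Prod>j=1..n. (x + b j) / (x + a j)) = 1 - (\<Sum>j=1..n. w j / (x + a j))"
    by (smt (verit) le_SucI)
  have AB: "B \<le> A" "A > 0"
    using Suc.prems(1,2)[of "Suc n"] by (auto simp: A_def B_def)
  have aB: "a j \<le> B" "a j > 0" if "j \<in> {1..n}" for j
    using that Suc.prems(1)[of j] Suc.prems(3)[of j "Suc n"] by (auto simp: B_def)
  show ?case
  proof (cases "A = B")
    case True
    have "(\<Prod>j=1..Suc n. (x + b j) / (x + a j)) = 1 - (\<Sum>j=1..Suc n. (w(Suc n := 0)) j / (x + a j))"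
      if "x \<ge> 0" for x
      using that True AB eq[OF that] by (simp add: A_def B_def)
    with w show ?thesis
      by (intro exI[of _ "w(Suc n := 0)"]) auto
  next
    case False
    \<comment> \<open>Partial fraction coefficients of
      \<open>(x + B) / ((x + a j) * (x + A))\<close>; they are nonnegative as
      \<open>a j \<le> B < A\<close>.\<close>
    define \<alpha> \<beta> where "\<alpha> j = (B - a j) / (A - a j)" and "\<beta> j = (A - B) / (A - a j)" for j
    \<comment> \<open>\<open>d\<close> collects all terms over \<open>x + A\<close>:
      \<open>A - B\<close> from the new factor itself, the sum from splitting the old terms.\<close>
    define d where "d = A - B + (\<Sum>j=1..n. w j * \<beta> j)"
    define w' where "w' j = (if j \<in> {1..n} then w j * \<alpha> j else if j = Suc n then d else 0)" for j
    have split: "1 / (x + a j) * ((x + B) / (x + A)) = \<alpha> j / (x + a j) + \<beta> j / (x + A)"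
      if "x \<ge> 0" "j \<in> {1..n}" for x j
    proof -
      have "A - a j > 0" "x + a j > 0" "x + A > 0"
        using aB[OF that(2)] AB False that(1) by auto
      then show ?thesis
        unfolding \<alpha>_def \<beta>_def by (simp add: divide_simps) (simp add: algebra_simps)
    qed
    have "\<alpha> j \<ge> 0" "\<beta> j \<ge> 0" if "j \<in> {1..n}" for j
      using aB[OF that] AB by (auto simp: \<alpha>_def \<beta>_def)
    then have w'_nonneg: "w' j \<ge> 0" for j
      using AB w by (auto simp: w'_def d_def intro!: add_nonneg_nonneg sum_nonneg)
    have "(\<Prod>j=1..Suc n. (x + b j) / (x + a j)) = 1 - (\<Sum>j=1..Suc n. w' j / (x + a j))"
      if x: "x \<ge> 0" for x
    proof -
      have "(\<Prod>j=1..Suc n. (x + b j) / (x + a j)) =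
          (x + B) / (x + A) - (\<Sum>j=1..n. w j * (1 / (x + a j) * ((x + B) / (x + A))))"
      proof -
        have "(\<Prod>j=1..Suc n. (x + b j) / (x + a j)) =
            (1 - (\<Sum>j=1..n. w j / (x + a j))) * ((x + B) / (x + A))"
          using eq[OF x] by (simp add: A_def B_def)
        then show ?thesis
          unfolding left_diff_distrib sum_distrib_right by simp
      qed
      also have "(\<Sum>j=1..n. w j * (1 / (x + a j) * ((x + B) / (x + A)))) =
          (\<Sum>j=1..n. w j * (\<alpha> j / (x + a j) + \<beta> j / (x + A)))"
        using split[OF x] by (intro sum.cong) auto
      also have "\<dots> = (\<Sum>j=1..n. w' j / (x + a j)) + (\<Sum>j=1..n. w j * \<beta> j) / (x + A)"
        by (simp add: w'_def distrib_left sum.distrib sum_divide_distrib)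
      also have "(x + B) / (x + A) = 1 - (A - B) / (x + A)"
        using AB x by (simp add: field_simps)
      finally show ?thesis
        by (simp add: w'_def d_def A_def add_divide_distrib)
    qed
    with w'_nonneg show ?thesis
      by blast
  qed
qed

section \<open>The rational net and its two boundary sequences\<close>

theorem corollary2p8:
  fixes k :: nat and a b :: "nat \<Rightarrow> real" and pa pb c :: "real \<Rightarrow> real" and F G :: "nat set"
  assumes k_pos: "k \<ge> 1"
    and a_pos: "\<And>j. j \<le> k \<Longrightarrow> a j > 0"
    and b_pos: "\<And>j. j \<le> k \<Longrightarrow> b j > 0"
    and pa: "\<And>x. x \<ge> 0 \<Longrightarrow> pa x = a 0 * (\<Prod>j=1..k. (x + a j))"
    and pb: "\<And>x. x \<ge> 0 \<Longrightarrow> pb x = b 0 * (\<Prod>j=1..k. (x + b j))"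
    and b_le_a: "\<And>j. 1 \<le> j \<Longrightarrow> j \<le> k \<Longrightarrow> b j \<le> a j"
    and a_le_b: "\<And>j. 1 \<le> j \<Longrightarrow> j < k \<Longrightarrow> a j \<le> b (j + 1)"
    and F: "F \<subseteq> {1..k}"
    and G: "G \<subseteq> {2..k}"
    and c: "(\<forall>x\<ge>0. c x = (\<Prod>j\<in>F. (x + a j))) \<or> (\<forall>x\<ge>0. c x = (\<Prod>j\<in>G. (x + b j)))"
  shows "minimal_joint_completely_monotone
           (\<lambda>m n. c (real m) / (pb (real m) + pa (real m) * real n))"
proof -
  have a_b: "a i \<le> b j" if "1 \<le> i" "i < j" "j \<le> k" for i j
    using that(2,3)
  proof (induction j)
    case (Suc j)
    show ?case
    proof (cases "i = j")
      case True
      with Suc.prems that(1) a_le_b[of j] show ?thesis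
        by simp
    next
      case False
      with Suc that(1) b_le_a[of j] a_le_b[of j] show ?thesis
        by simp
    qed
  qed simp
  obtain w where w: "\<And>j. w j \<ge> 0" and eq: "\<And>x. x \<ge> 0 \<Longrightarrow>
      (\<Prod>j=1..k. (x + b j) / (x + a j)) = 1 - (\<Sum>j=1..k. w j / (x + a j))"
    using interlacing_partial_fractions[of k a b] a_pos b_le_a a_b by blast
  \<comment> \<open>\<open>K\<close> is the ratio of the leading coefficients. It also scales
    \<open>s\<close>, as the partial fractions concern the monic quotient.\<close>
  define K where "K = b 0 / a 0"
  define s where "s m = (\<Sum>j=1..k. (K * w j) * (1 / (real m + a j)))" for m :: nat
  define A where "A m = c (real m) / pa (real m)" for m :: nat
  have a0: "a 0 > 0" and b0: "b 0 > 0" and K: "K > 0"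
    using a_pos b_pos by (auto simp: K_def)
  have pa_pos: "pa (real m) > 0" and pb_pos: "pb (real m) > 0" for m
    using a0 b0 a_pos b_pos by (auto simp: pa pb intro!: mult_pos_pos prod_pos add_nonneg_pos)
  have ratio: "pb (real m) / pa (real m) = K - s m" for m
  proof -
    have "pb (real m) / pa (real m) = K * (\<Prod>j=1..k. (real m + b j) / (real m + a j))"
      by (simp add: pa pb K_def prod_dividef)
    also have "\<dots> = K - s m"
      using eq[of "real m"] by (simp add: s_def right_diff_distrib sum_distrib_left)
    finally show ?thesis .
  qed
  have s: "completely_monotone s"
    unfolding s_def using K w a_pos
    by (intro completely_monotone_sum completely_monotone_mult completely_monotone_const
        completely_monotone_inverse_shift) auto
  \<comment> \<open>\<open>K - s 0\<close> is the positive ratio \<open>pb 0 / pa 0\<close>.\<close>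
  have s0: "s 0 < K"
    using divide_pos_pos[OF pb_pos[of 0] pa_pos[of 0]] unfolding ratio by simp
  have net: "c (real m) / (pb (real m) + pa (real m) * real n) = A m / (real n + (K - s m))" for m n
    using pa_pos[of m] by (simp add: A_def ratio[symmetric] field_simps)
  \<comment> \<open>\<open>A\<close> yields joint complete monotonicity; \<open>c / pb\<close> is
    the boundary sequence at \<open>n = 0\<close>.\<close>
  have "no_atom_at_0 A \<and> no_atom_at_0 (\<lambda>m. c (real m) / pb (real m))"
    using c
  proof
    assume c: "\<forall>x\<ge>0. c x = (\<Prod>j\<in>F. (x + a j))"
    have "no_atom_at_0 (\<lambda>m. 1 / a 0 * ((\<Prod>j\<in>F. (real m + a j)) / (\<Prod>j=1..k. (real m + a j))))"
      using F a0 a_pos by (intro no_atom_at_0_cmult no_atom_at_0_prod_quotient) (auto intro: less_imp_le)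
    \<comment> \<open>Here \<open>x + a j\<close> is paired with \<open>x + b j\<close>, using
      \<open>b j \<le> a j\<close>; over \<open>pa\<close> it was paired with itself.\<close>
    moreover have "no_atom_at_0 (\<lambda>m. 1 / b 0 * ((\<Prod>j\<in>F. (real m + a j)) / (\<Prod>j=1..k. (real m + b j))))"
      using F b0 b_pos b_le_a by (intro no_atom_at_0_cmult no_atom_at_0_prod_quotient) (auto intro: less_imp_le)
    ultimately show ?thesis
      by (simp add: A_def[abs_def] c pa pb)
  next
    assume c: "\<forall>x\<ge>0. c x = (\<Prod>j\<in>G. (x + b j))"
    \<comment> \<open>The factors \<open>x + b j\<close> of \<open>c\<close> are paired with \<open>x + a (j - 1)\<close>, since \<open>a (j - 1) \<le> b j\<close>.\<close>
    define G' where "G' = {j. Suc j \<in> G}"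
    have "G = Suc ` G'"
    proof
      show "G \<subseteq> Suc ` G'"
      proof
        fix j
        assume "j \<in> G"
        with G have "j = Suc (j - 1)"
          by auto
        with \<open>j \<in> G\<close> show "j \<in> Suc ` G'"
          by (metis G'_def imageI mem_Collect_eq)
      qed
    qed (auto simp: G'_def)
    then have reindex: "(\<Prod>j\<in>G. (x + b j)) = (\<Prod>j\<in>G'. (x + b (Suc j)))" for x
      by (simp add: prod.reindex)
    have "no_atom_at_0 (\<lambda>m. 1 / a 0 * ((\<Prod>j\<in>G'. (real m + b (Suc j))) / (\<Prod>j=1..k. (real m + a j))))"
      using G a0 a_pos a_b
      by (intro no_atom_at_0_cmult no_atom_at_0_prod_quotient) (auto simp: G'_def intro: less_imp_le)
    moreover have "no_atom_at_0 (\<lambda>m. 1 / b 0 * ((\<Prod>j\<in>G. (real m + b j)) / (\<Prod>j=1..k. (real m + b j))))"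
      using G b0 b_pos by (intro no_atom_at_0_cmult no_atom_at_0_prod_quotient) (auto intro: less_imp_le)
    ultimately show ?thesis
      by (simp add: A_def[abs_def] c pa pb reindex)
  qed
  then have A: "no_atom_at_0 A" and col: "no_atom_at_0 (\<lambda>m. c (real m) / pb (real m))"
    by auto
  have joint: "joint_completely_monotone (\<lambda>m n. A m / (real n + (K - s m)))"
    using A by (intro joint_completely_monotone_quotient s s0) (simp add: no_atom_at_0_def)
  \<comment> \<open>At \<open>m = 0\<close> the net is a nonnegative constant divided by
    \<open>n + (K - s 0)\<close>.\<close>
  have row: "no_atom_at_0 (\<lambda>n. A 0 / (real n + (K - s 0)))"
    using A s0 by (intro no_atom_at_0_divide no_atom_at_0_const)
      (auto simp: no_atom_at_0_def completely_monotone_nonneg)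
  show ?thesis
    unfolding minimal_joint_completely_monotone_def
  proof (intro conjI allI impI)
    show "joint_completely_monotone (\<lambda>m n. c (real m) / (pb (real m) + pa (real m) * real n))"
      using joint by (simp only: net)
  next
    fix \<epsilon> :: real
    assume \<epsilon>: "\<epsilon> > 0"
    show "\<not> completely_monotone (\<lambda>m. c (real m) / (pb (real m) + pa (real m) * real 0)
        - \<epsilon> * indicat_real {0} m)"
      using not_completely_monotone_minus_indicator[OF col \<epsilon>] by simp
    show "\<not> completely_monotone (\<lambda>n. c (real 0) / (pb (real 0) + pa (real 0) * real n)
        - \<epsilon> * indicat_real {0} n)"
      using not_completely_monotone_minus_indicator[OF row \<epsilon>] unfolding net .
  qed
qed

end
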